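(* In the setting of the context, the net (global) probability $P_F(\mu)=\int_\chi\nu_F(x',\mu)\,dx'$ of a false alarm at threshold $\mu>0$ is determined by the net a posteriori probability of detection $P_D(\mu)=\int_\chi a'(x)\,p_D(x,\mu)\,dx$ through $$P_F(\mu)=-\int_\mu^\infty\frac1{\mu'}\,dP_D(\mu').$$
   Context: Setting (joint Bayesian detection and estimation). "No signal" has prior probability $a_0>0$, and signal parameters $x$ in a $d$-dimensional continuous domain $\chi$ have prior density $a(x)$, with $a_0+\int_\chi a=1$. The measurement $\mathbf m$ has density $p_0(\mathbf m)$ with no signal and $p_1(\mathbf m|x)$ with signal at $x$, and marginal $p(\mathbf m)=a_0p_0(\mathbf m)+\int_\chi a(x)p_1(\mathbf m|x)dx$. $C(x')>0$ is the false-alarm cost for a declaration at $x'$. $R(x',x)\ge0$ is the reward (cost of declaring a signal at $x$ absent minus cost of declaring it present at $x'$). With false-alarm cost scaled by a factor $\mu>0$, the decision statistic is $$T(x',\mu|\mathbf m)=\frac1{p(\mathbf m)}\left[\int_\chi R(x',x)p_1(\mathbf m|x)a(x)dx-\mu C(x')p_0(\mathbf m)a_0\right],$$ and a signal is declared at the maximizing location $x_{\mathbf m}$ when $T(x_{\mathbf m},\mu|\mathbf m)>0$. The factor $\mu$ acts as a variable threshold. Densities: $p_D(x'|x,\mu)$ is the density in $x'$ of declarations at $x'$ when a signal is present at $x$, i.e. $p_D(x'|x,\mu)=\int_{T(x_{\mathbf m},\mu|\mathbf m)>0}\delta(x'-x_{\mathbf m})p_1(\mathbf m|x)d\mathbf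 m$ ($\delta$ the Dirac delta). $\nu_F(x',\mu)$ is the density in $x'$ of declarations at $x'$ when no signal is present (same with $p_0$ in place of $p_1$). The detection probability of a signal at $x$ is $p_D(x,\mu)=\int_\chi p_D(x'|x,\mu)\,dx'$. Pseudo-prior: the $x$-dependence of costs and rewards is combined with that of the prior into a density $a'(x)$ proportional to $R(x,x)a(x)/(C(x)a_0)$, normalized so that $\int_\chi a'(x)\,dx=1$, the constant factor being absorbed into the threshold $\mu$. The standing approximation is that prior, costs and rewards vary negligibly over the region of $x'$ near $x$ where $p_D(x'|x,\mu)$ is significant, so that $a'(x')$ may be replaced by $a'(x)$ there. Under it, the false-alarm and detection densities satisfy $$\nu_F(x',\mu)=-\int_\mu^\infty\frac1{\mu'}\frac{\partial}{\partial\mu'}\left[\int_\chi a'(x)\,p_D(x'|x,\mu')\,dx\right]d\mu' .$$ All densities are assumed regular enough (differentiable in $\mu$, with interchange of integrals and derivatives permitted), with detections vanishing as $\mu\to\infty$. *)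

theory Defs
  imports "HOL-Analysis.Analysis"
begin

abbreviation vol_on :: "'a::euclidean_space set \<Rightarrow> 'a measure" where
  "vol_on X \<equiv> restrict_space lborel X"

definition marginal ::
  "'a::euclidean_space set \<Rightarrow> real \<Rightarrow> ('a \<Rightarrow> real) \<Rightarrow> ('m \<Rightarrow> real) \<Rightarrow> ('m \<Rightarrow> 'a \<Rightarrow> real) \<Rightarrow> 'm \<Rightarrow> real"
  where "marginal X a0 a p0 p1 m = a0 * p0 m + (\<integral>x. a x * p1 m x \<partial>vol_on X)"

definition decision_stat ::
  "'a::euclidean_space set \<Rightarrow> real \<Rightarrow> ('a \<Rightarrow> real) \<Rightarrow> ('m \<Rightarrow> real) \<Rightarrow> ('m \<Rightarrow> 'a \<Rightarrow> real)
    \<Rightarrow> ('a \<Rightarrow> real) \<Rightarrow> ('a \<Rightarrow> 'a \<Rightarrow> real) \<Rightarrow> 'a \<Rightarrow> real \<Rightarrow> 'm \<Rightarrow> real"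
  where "decision_stat X a0 a p0 p1 C R x' \<mu> m =
    1 / marginal X a0 a p0 p1 m *
      ((\<integral>x. R x' x * p1 m x * a x \<partial>vol_on X) - \<mu> * C x' * p0 m * a0)"

definition cost_scale ::
  "'a::euclidean_space set \<Rightarrow> real \<Rightarrow> ('a \<Rightarrow> real) \<Rightarrow> ('a \<Rightarrow> real) \<Rightarrow> ('a \<Rightarrow> 'a \<Rightarrow> real) \<Rightarrow> real"
  where "cost_scale X a0 a C R = (\<integral>x. R x x * a x / (C x * a0) \<partial>vol_on X)"

definition pseudo_prior ::
  "'a::euclidean_space set \<Rightarrow> real \<Rightarrow> ('a \<Rightarrow> real) \<Rightarrow> ('a \<Rightarrow> real) \<Rightarrow> ('a \<Rightarrow> 'a \<Rightarrow> real) \<Rightarrow> 'a \<Rightarrow> real"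
  where "pseudo_prior X a0 a C R x = R x x * a x / (C x * a0) / cost_scale X a0 a C R"

text \<open>The measurement densities are taken with respect to a sigma-finite reference measure
  \<open>M\<close> on the measurement space.\<close>

locale joint_detection = sigma_finite_measure M
  for M :: "'m measure" +
  fixes X :: "'a::euclidean_space set"
    and a0 :: real
    and a :: "'a \<Rightarrow> real"
    and p0 :: "'m \<Rightarrow> real"
    and p1 :: "'m \<Rightarrow> 'a \<Rightarrow> real"
    and C :: "'a \<Rightarrow> real"
    and R :: "'a \<Rightarrow> 'a \<Rightarrow> real"
  assumes domain_borel: "X \<in> sets borel"
    and a0_pos: "0 < a0"
    and a_nonneg: "\<And>x. x \<in> X \<Longrightarrow> 0 \<le> a x"
    and a_integrable: "integrable (vol_on X) a"
    and prior_total: "a0 + (\<integral>x. a x \<partial>vol_on X) = 1"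
    and p0_nonneg: "\<And>m. m \<in> space M \<Longrightarrow> 0 \<le> p0 m"
    and p0_integrable: "integrable M p0"
    and p0_total: "(\<integral>m. p0 m \<partial>M) = 1"
    and p1_measurable: "(\<lambda>(m, x). p1 m x) \<in> borel_measurable (M \<Otimes>\<^sub>M vol_on X)"
    and p1_nonneg: "\<And>m x. m \<in> space M \<Longrightarrow> x \<in> X \<Longrightarrow> 0 \<le> p1 m x"
    and p1_integrable: "\<And>x. x \<in> X \<Longrightarrow> integrable M (\<lambda>m. p1 m x)"
    and p1_total: "\<And>x. x \<in> X \<Longrightarrow> (\<integral>m. p1 m x \<partial>M) = 1"
    and C_measurable: "C \<in> borel_measurable (vol_on X)"
    and C_pos: "\<And>x. x \<in> X \<Longrightarrow> 0 < C x"
    and R_measurable: "(\<lambda>(x', x). R x' x) \<in> borel_measurable (vol_on X \<Otimes>\<^sub>M vol_on X)"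
    and R_nonneg: "\<And>x' x. x' \<in> X \<Longrightarrow> x \<in> X \<Longrightarrow> 0 \<le> R x' x"
    and reward_integrable:
      "AE m in M. \<forall>x'\<in>X. integrable (vol_on X) (\<lambda>x. R x' x * p1 m x * a x)"
    and pseudo_prior_normalizable:
      "integrable (vol_on X) (\<lambda>x. R x x * a x / (C x * a0))"
      "0 < cost_scale X a0 a C R"

text \<open>\<open>f\<close> is the density, in the declared location, of declarations made when the
  measurement has density \<open>q\<close>: formally
  \<open>f x' = \<integral> \<delta>(x' - loc m) q(m) dm\<close> over the measurements with \<open>0 < S (loc m) m\<close>.
  The Dirac delta is read as saying that \<open>f\<close> is a density of the image, under \<open>loc\<close>, of the
  law of the measurement restricted to that event. (It is a sub-probability density, since
  possibly nothing is declared.)\<close>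

definition declaration_density ::
  "'m measure \<Rightarrow> 'a::euclidean_space set \<Rightarrow> ('a \<Rightarrow> 'm \<Rightarrow> real) \<Rightarrow> ('m \<Rightarrow> 'a) \<Rightarrow> ('m \<Rightarrow> real)
    \<Rightarrow> ('a \<Rightarrow> real) \<Rightarrow> bool"
  where "declaration_density M X S loc q f \<longleftrightarrow>
    f \<in> borel_measurable (vol_on X) \<and> (\<forall>x'\<in>X. 0 \<le> f x') \<and>
    distr (density M (\<lambda>m. ennreal (q m) * indicator {m \<in> space M. 0 < S (loc m) m} m)) (vol_on X) loc
      = density (vol_on X) (\<lambda>x'. ennreal (f x'))"

definition detection_prob ::
  "'a::euclidean_space set \<Rightarrow> ('a \<Rightarrow> 'a \<Rightarrow> real \<Rightarrow> real) \<Rightarrow> 'a \<Rightarrow> real \<Rightarrow> real"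
  where "detection_prob X pD x \<mu> = (\<integral>x'. pD x' x \<mu> \<partial>vol_on X)"

definition net_detection_prob ::
  "'a::euclidean_space set \<Rightarrow> ('a \<Rightarrow> real) \<Rightarrow> ('a \<Rightarrow> 'a \<Rightarrow> real \<Rightarrow> real) \<Rightarrow> real \<Rightarrow> real"
  where "net_detection_prob X a' pD \<mu> = (\<integral>x. a' x * detection_prob X pD x \<mu> \<partial>vol_on X)"

definition net_detection_density ::
  "'a::euclidean_space set \<Rightarrow> ('a \<Rightarrow> real) \<Rightarrow> ('a \<Rightarrow> 'a \<Rightarrow> real \<Rightarrow> real) \<Rightarrow> 'a \<Rightarrow> real \<Rightarrow> real"
  where "net_detection_density X a' pD x' \<mu> = (\<integral>x. a' x * pD x' x \<mu> \<partial>vol_on X)"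

definition net_false_alarm_prob ::
  "'a::euclidean_space set \<Rightarrow> ('a \<Rightarrow> real \<Rightarrow> real) \<Rightarrow> real \<Rightarrow> real"
  where "net_false_alarm_prob X \<nu>F \<mu> = (\<integral>x'. \<nu>F x' \<mu> \<partial>vol_on X)"

text \<open>The Lebesgue--Stieltjes integral of \<open>f\<close> with respect to \<open>dG\<close> over \<open>(\<mu>, \<infinity>)\<close>, for an
  integrator \<open>G\<close> that is nonincreasing and right-continuous on \<open>[\<mu>, \<infinity>)\<close>.
  \<^const>\<open>interval_measure\<close> expects a nondecreasing integrator on the whole line: hence the
  two signs, and the \<open>max\<close>, which makes the integrator constant to the left of \<open>\<mu>\<close>,
  where \<open>G\<close> need not be meaningful. A detection probability is nonincreasing in the threshold,
  so this is the case needed here.\<close>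

definition stieltjes_tail_integral :: "(real \<Rightarrow> real) \<Rightarrow> (real \<Rightarrow> real) \<Rightarrow> real \<Rightarrow> real"
  where "stieltjes_tail_integral f G \<mu> =
    - (LINT t:{\<mu><..}|interval_measure (\<lambda>t. - G (max \<mu> t)). f t)"

text \<open>The declaration densities indexed by the threshold \<open>\<mu>\<close> are those of the decision
  rule with cost factor \<open>\<kappa> * \<mu>\<close>, where \<open>\<kappa>\<close> is \<^const>\<open>cost_scale\<close>: this is the
  absorption into the threshold of the constant that normalizes the pseudo-prior. On the
  decision boundary the statistic at cost factor \<open>\<kappa> * \<mu>\<close> vanishes, and
  \<open>p0 m = 1/\<mu> * \<integral> R x' x * a x / (\<kappa> * C x' * a0) * p1 m x dx\<close>, whose weight is the
  pseudo-prior when \<open>x'\<close> is identified with \<open>x\<close>.\<close>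

locale declared_densities = joint_detection M X a0 a p0 p1 C R
  for M :: "'m measure" and X :: "'a::euclidean_space set" and a0 a p0 p1 C R +
  fixes xm :: "real \<Rightarrow> 'm \<Rightarrow> 'a"
    and pD :: "'a \<Rightarrow> 'a \<Rightarrow> real \<Rightarrow> real"
    and \<nu>F :: "'a \<Rightarrow> real \<Rightarrow> real"
  assumes xm_measurable: "\<And>\<mu>. 0 < \<mu> \<Longrightarrow> xm \<mu> \<in> measurable M (vol_on X)"
    and xm_maximizes: "\<And>\<mu>. 0 < \<mu> \<Longrightarrow>
      AE m in M. is_arg_max (\<lambda>x'. decision_stat X a0 a p0 p1 C R x' \<mu> m) (\<lambda>x'. x' \<in> X) (xm \<mu> m)"
    and pD_density: "\<And>\<mu> x. 0 < \<mu> \<Longrightarrow> x \<in> X \<Longrightarrow>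
      declaration_density M X
        (\<lambda>x' m. decision_stat X a0 a p0 p1 C R x' (cost_scale X a0 a C R * \<mu>) m)
        (xm (cost_scale X a0 a C R * \<mu>)) (\<lambda>m. p1 m x) (\<lambda>x'. pD x' x \<mu>)"
    and \<nu>F_density: "\<And>\<mu>. 0 < \<mu> \<Longrightarrow>
      declaration_density M X
        (\<lambda>x' m. decision_stat X a0 a p0 p1 C R x' (cost_scale X a0 a C R * \<mu>) m)
        (xm (cost_scale X a0 a C R * \<mu>)) p0 (\<lambda>x'. \<nu>F x' \<mu>)"

end

theory Submission
  imports Defs
begin

text \<open>
  Write \<open>g x' s\<close> for the detection density averaged over the pseudo-prior,
  \<^const>\<open>net_detection_density\<close>, and \<open>G\<close> for \<^const>\<open>net_detection_prob\<close>. Integrating the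
  relation between the densities over the declared location \<open>x'\<close> and exchanging the two
  integrals gives \<open>P\<^sub>F(\<mu>) = - \<integral> h(s)/s ds\<close> over \<open>s > \<mu>\<close>, where \<open>h(s)\<close> is the integral of
  \<open>\<partial>g(x', s)/\<partial>s\<close> over \<open>x'\<close>. It remains to identify \<open>h(s) ds\<close> with \<open>dG(s)\<close>.

  Two facts make this identification possible. The first is that \<open>h\<close> is a density of \<open>dG\<close>.
  For almost every \<open>x'\<close> the derivative of \<open>g x'\<close> is Lebesgue integrable on bounded
  intervals, so the fundamental theorem of calculus recovers the increments of \<open>g x'\<close>;
  integrating over \<open>x'\<close> yields \<open>G v - G u = \<integral> h(s) ds\<close> over \<open>u < s \<le> v\<close>
  (\<open>integral_of_primitives\<close>). Here \<open>G\<close> is the integral of \<open>g\<close> over \<open>x'\<close> by Fubini's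
  theorem, which applies because declaration densities are nonnegative with mass at most 1
  (\<open>net_detection_prob_eq_integral\<close>).

  The second is that \<open>G\<close> is nonincreasing, so that \<open>dG\<close> is a (negative) measure. The
  decision statistic is nonincreasing in the threshold at every location; so is its maximum over
  the locations, and the set of measurements that lead to a declaration shrinks up to null sets
  (\<open>declared_antimono\<close>). The individual densities \<open>pD x' x \<mu>\<close> need not be monotone in
  \<open>\<mu>\<close>, because the maximizing location moves with the threshold: monotonicity holds only
  after integration over \<open>x'\<close>.

  The final comparison of \<open>\<integral> 1/s dG(s)\<close> with \<open>\<integral> h(s)/s ds\<close> uses
  \<open>1/s = \<integral> 1/t\<^sup>2 dt\<close> over \<open>t \<ge> s\<close>. Exchanging integrals turns either side into the
  integral of \<open>(G t - G \<mu>)/t\<^sup>2\<close> over \<open>t > \<mu>\<close> (\<open>stieltjes_tail_integral_inverse\<close>).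
\<close>

section \<open>Stieltjes integrals of \<open>1/s\<close> against an absolutely continuous integrator\<close>

lemma set_integrable_Ioc_imp_Icc:
  fixes f :: "real \<Rightarrow> real"
  assumes "set_integrable lborel {u<..v} f"
  shows "f integrable_on {u..v}" "(LINT s:{u<..v}|lborel. f s) = integral {u..v} f"
proof -
  have iff: "(f has_integral y) {u<..v} \<longleftrightarrow> (f has_integral y) {u..v}" for y
    by (rule has_integral_spike_set_eq; rule negligible_subset[of "{u}"]) auto
  note hk = set_borel_integral_eq_integral[OF assms]
  show "f integrable_on {u..v}"
    using hk(1) iff unfolding integrable_on_def by blast
  show "(LINT s:{u<..v}|lborel. f s) = integral {u..v} f"
    using hk iff by (metis integrable_integral integral_unique)
qed

text \<open>On a bounded interval the weight \<open>1/s\<close> is bounded away from 0, so an integrability hypothesis with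
  this weight controls the function itself there.\<close>

lemma set_integrable_mult_ident:
  fixes f :: "real \<Rightarrow> real"
  assumes "0 < u" "set_integrable lborel {u<..} (\<lambda>s. 1 / s * f s)"
  shows "set_integrable lborel {u<..v} f"
proof -
  have [measurable]: "(\<lambda>s. indicator {u<..} s * (1 / s * f s)) \<in> borel_measurable borel"
    using assms(2) unfolding set_integrable_def by (auto dest: borel_measurable_integrable)
  have eq: "(\<lambda>s. indicator {u<..v} s * f s)
      = (\<lambda>s. indicator {u<..v} s * s * (indicator {u<..} s * (1 / s * f s)))"
    using assms(1) by (auto simp: indicator_def)
  show ?thesis
    unfolding set_integrable_def
  proof (rule Bochner_Integration.integrable_bound)
    show "integrable lborel (\<lambda>s. v * (indicator {u<..} s * (1 / s * f s)))"
      by (rule integrable_mult_right) (use assms(2) in \<open>simp add: set_integrable_def\<close>)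
    show "(\<lambda>s. indicator {u<..v} s *\<^sub>R f s) \<in> borel_measurable lborel"
      unfolding real_scaleR_def by (subst eq) measurable
    show "AE s in lborel. norm (indicator {u<..v} s *\<^sub>R f s)
        \<le> norm (v * (indicator {u<..} s * (1 / s * f s)))"
      using assms(1) by (auto simp: indicator_def abs_mult field_simps intro!: AE_I2 mult_right_mono)
  qed
qed

text \<open>The layer-cake form of \<open>1/s\<close>, both for the nonnegative integral and for the Bochner integral,
  since it is used once against a measure and once against a signed density.\<close>

lemma inverse_eq_tail_integral:
  fixes s :: real
  assumes "0 < s"
  shows "(\<integral>\<^sup>+t. ennreal (indicator {s..} t / t\<^sup>2) \<partial>lborel) = ennreal (1 / s)"
    and "integrable lborel (\<lambda>t. indicator {s..} t / t\<^sup>2)"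
    and "(\<integral>t. indicator {s..} t / t\<^sup>2 \<partial>lborel) = 1 / s"
proof -
  have "(\<integral>\<^sup>+t. ennreal (1 / t\<^sup>2) * indicator {s..} t \<partial>lborel) = ennreal (0 - (- 1 / s))"
  proof (rule nn_integral_FTC_atLeast)
    show "((\<lambda>t. - 1 / t) has_real_derivative 1 / t\<^sup>2) (at t)" if "s \<le> t" for t :: real
      using that assms by (auto intro!: derivative_eq_intros simp: power2_eq_square)
    show "((\<lambda>t::real. - 1 / t) \<longlongrightarrow> 0) at_top"
      by (rule tendsto_divide_0[OF tendsto_const filterlim_at_top_imp_at_infinity[OF filterlim_ident]])
  qed auto
  moreover have "(\<integral>\<^sup>+t. ennreal (1 / t\<^sup>2) * indicator {s..} t \<partial>lborel)
      = (\<integral>\<^sup>+t. ennreal (indicator {s..} t / t\<^sup>2) \<partial>lborel)"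
    by (intro nn_integral_cong) (auto simp: indicator_def)
  ultimately show nn: "(\<integral>\<^sup>+t. ennreal (indicator {s..} t / t\<^sup>2) \<partial>lborel) = ennreal (1 / s)"
    by simp
  show "integrable lborel (\<lambda>t. indicator {s..} t / t\<^sup>2)"
    by (rule integrableI_nonneg) (auto simp: nn)
  show "(\<integral>t. indicator {s..} t / t\<^sup>2 \<partial>lborel) = 1 / s"
    using assms by (subst integral_eq_nn_integral) (auto simp: nn)
qed

text \<open>Continuity of the truncated integrator is what gives \<^const>\<open>interval_measure\<close> the expected
  values on half-open intervals.\<close>

lemma continuous_truncated_primitive:
  fixes G h :: "real \<Rightarrow> real"
  assumes int: "\<And>b. set_integrable lborel {\<mu><..b} h"
    and primitive: "\<And>t. \<mu> \<le> t \<Longrightarrow> G t - G \<mu> = (LINT s:{\<mu><..t}|lborel. h s)"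
  shows "isCont (\<lambda>t. G (max \<mu> t)) a"
proof -
  have cont: "continuous_on {\<mu>..b} G" for b
  proof -
    have "continuous_on {\<mu>..b} (\<lambda>t. G \<mu> + integral {\<mu>..t} h)"
      using set_integrable_Ioc_imp_Icc(1)[OF int]
      by (intro continuous_intros indefinite_integral_continuous_1)
    moreover have "G \<mu> + integral {\<mu>..t} h = G t" if "t \<in> {\<mu>..b}" for t
      using primitive[of t] set_integrable_Ioc_imp_Icc(2)[OF int, of t] that by simp
    ultimately show ?thesis
      by (rule continuous_on_eq)
  qed
  have "continuous_on {..<a + 1} (\<lambda>t. G (max \<mu> t))"
    by (rule continuous_on_compose2[OF cont[of "max \<mu> (a + 1)"]]) (auto intro!: continuous_intros)
  then show ?thesis
    by (simp add: continuous_on_eq_continuous_at)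
qed

text \<open>For a nonincreasing \<open>G\<close> with density \<open>h\<close>, \<open>dG\<close> may be replaced by \<open>h(s) ds\<close>. The sign
  of \<open>h\<close> is known only almost everywhere and only through \<open>G\<close>, so the two measures are not
  compared directly. Instead \<open>1/s\<close> is spread over its tail integral: after an exchange of
  integrals, both sides see the integrator only through its increments \<open>G \<mu> - G t\<close>. On the
  Stieltjes side the exchange is Tonelli's theorem; on the density side it is Fubini's, which
  applies because \<open>h(s)/s\<close> is integrable.\<close>

lemma stieltjes_tail_integral_inverse:
  fixes G h :: "real \<Rightarrow> real"
  assumes pos: "0 < \<mu>"
    and antimono: "\<And>s t. \<mu> \<le> s \<Longrightarrow> s \<le> t \<Longrightarrow> G t \<le> G s"
    and int: "set_integrable lborel {\<mu><..} (\<lambda>s. 1 / s * h s)"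
    and primitive: "\<And>t. \<mu> \<le> t \<Longrightarrow> G t - G \<mu> = (LINT s:{\<mu><..t}|lborel. h s)"
  shows "stieltjes_tail_integral (\<lambda>s. 1 / s) G \<mu> = (LINT s:{\<mu><..}|lborel. 1 / s * h s)"
proof -
  define F where "F t = - G (max \<mu> t)" for t
  define N where "N = interval_measure F"
  \<comment> \<open>integrating \<open>K s t\<close> over \<open>t\<close> gives \<open>1/s\<close> for \<open>s > \<mu>\<close>; as a function of \<open>s\<close> it is
    \<open>1/t\<^sup>2\<close> on the interval from \<open>\<mu>\<close> to \<open>t\<close>\<close>
  define K where "K s t = indicator {\<mu><..} s * (indicator {s..} t / t\<^sup>2)" for s t :: real
  define \<phi> where "\<phi> t = indicator {\<mu><..} t * (G \<mu> - G t) / t\<^sup>2" for t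
  note loc_int = set_integrable_mult_ident[OF pos int]
  have F_mono: "F s \<le> F t" if "s \<le> t" for s t
    using antimono[of "max \<mu> s" "max \<mu> t"] that by (simp add: F_def)
  have F_isCont: "isCont F t" for t
    unfolding F_def by (intro continuous_minus continuous_truncated_primitive[OF loc_int primitive])
  then have F_right: "continuous (at_right t) F" for t
    using continuous_at_imp_continuous_at_within by blast
  have F_borel [measurable]: "F \<in> borel_measurable borel"
    using F_isCont by (intro borel_measurable_continuous_onI) (simp add: continuous_at_imp_continuous_on)
  have sets_N [measurable_cong]: "sets N = sets borel"
    by (simp add: N_def)
  interpret N: sigma_finite_measure N
    unfolding N_def by (rule sigma_finite_interval_measure[OF F_mono F_right])
  interpret NL: pair_sigma_finite N lborel ..
  \<comment> \<open>a form in which joint measurability is visible\<close>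
  have K_eq: "K s t = indicator {\<mu><..} s * ((if s \<le> t then 1 else 0) / t\<^sup>2)" for s t
    by (simp add: K_def indicator_def)
  have \<phi>_eq: "\<phi> t = indicator {\<mu><..} t * (F t - F \<mu>) / t\<^sup>2" for t
    by (auto simp: \<phi>_def F_def indicator_def max_def)
  have \<phi>_borel [measurable]: "\<phi> \<in> borel_measurable borel"
    unfolding \<phi>_eq by measurable
  have \<phi>_nonneg: "0 \<le> \<phi> t" for t
    unfolding \<phi>_eq using F_mono[of \<mu> t] by (auto simp: indicator_def)
  have stieltjes: "(LINT s:{\<mu><..}|N. 1 / s) = (\<integral>t. \<phi> t \<partial>lborel)"
  proof -
    have "(LINT s:{\<mu><..}|N. 1 / s) = enn2real (\<integral>\<^sup>+s. ennreal (indicator {\<mu><..} s * (1 / s)) \<partial>N)"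
      unfolding set_lebesgue_integral_def real_scaleR_def using pos
      by (intro integral_eq_nn_integral) (auto simp: indicator_def)
    also have "(\<integral>\<^sup>+s. ennreal (indicator {\<mu><..} s * (1 / s)) \<partial>N)
        = (\<integral>\<^sup>+s. (\<integral>\<^sup>+t. ennreal (K s t) \<partial>lborel) \<partial>N)"
      using pos by (intro nn_integral_cong) (auto simp: K_def indicator_def[of "{\<mu><..}"] inverse_eq_tail_integral(1))
    also have "\<dots> = (\<integral>\<^sup>+t. (\<integral>\<^sup>+s. ennreal (K s t) \<partial>N) \<partial>lborel)"
      unfolding K_eq by (rule NL.Fubini'[symmetric]) measurable
    also have "\<dots> = (\<integral>\<^sup>+t. ennreal (\<phi> t) \<partial>lborel)"
    proof (rule nn_integral_cong)
      fix t :: real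
      have "(\<integral>\<^sup>+s. ennreal (K s t) \<partial>N) = (\<integral>\<^sup>+s. ennreal (1 / t\<^sup>2) * indicator {\<mu><..t} s \<partial>N)"
        by (intro nn_integral_cong) (auto simp: K_def indicator_def)
      also have "\<dots> = ennreal (1 / t\<^sup>2) * emeasure N {\<mu><..t}"
        by (simp add: nn_integral_cmult_indicator sets_N)
      also have "emeasure N {\<mu><..t} = ennreal (if \<mu> \<le> t then F t - F \<mu> else 0)"
        unfolding N_def by (rule emeasure_interval_measure_Ioc_eq[OF F_mono F_right])
      also have "ennreal (1 / t\<^sup>2) * \<dots> = ennreal (\<phi> t)"
        unfolding \<phi>_eq using F_mono[of \<mu> t] by (auto simp: indicator_def ennreal_mult[symmetric])
      finally show "(\<integral>\<^sup>+s. ennreal (K s t) \<partial>N) = ennreal (\<phi> t)" .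
    qed
    also have "enn2real \<dots> = (\<integral>t. \<phi> t \<partial>lborel)"
      using \<phi>_nonneg by (subst integral_eq_nn_integral) auto
    finally show ?thesis .
  qed
  have density: "(LINT s:{\<mu><..}|lborel. 1 / s * h s) = - (\<integral>t. \<phi> t \<partial>lborel)"
  proof -
    define h' where "h' s = indicator {\<mu><..} s * h s" for s
    have int': "integrable lborel (\<lambda>s. 1 / s * h' s)"
      using int by (simp add: set_integrable_def h'_def mult.left_commute)
    \<comment> \<open>measurability of \<open>h\<close> itself on the half-line has to be read off from that of \<open>h(s)/s\<close>\<close>
    have "h' = (\<lambda>s. s * (1 / s * h' s))"
      using pos by (auto simp: h'_def indicator_def)
    moreover have "(\<lambda>s. s * (1 / s * h' s)) \<in> borel_measurable lborel"
      by (rule borel_measurable_times[OF _ borel_measurable_integrable[OF int']]) simp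
    ultimately have h'_borel [measurable]: "h' \<in> borel_measurable borel"
      by simp
    have K_int: "(\<integral>t. K s t \<partial>lborel) = indicator {\<mu><..} s * (1 / s)" for s
      using inverse_eq_tail_integral(3)[of s] pos by (cases "\<mu> < s") (simp_all add: K_def)
    have inner_s: "(\<integral>t. h' s * K s t \<partial>lborel) = 1 / s * h' s"
      "(\<integral>t. norm (h' s * K s t) \<partial>lborel) = norm (1 / s * h' s)"
      "integrable lborel (\<lambda>t. h' s * K s t)" for s
    proof -
      show "(\<integral>t. h' s * K s t \<partial>lborel) = 1 / s * h' s"
        unfolding integral_mult_right_zero K_int by (simp add: h'_def indicator_def)
      have "norm (h' s * K s t) = norm (h' s) * K s t" for t
        by (simp add: K_def abs_mult indicator_def)
      then have "(\<integral>t. norm (h' s * K s t) \<partial>lborel) = norm (h' s) * (indicator {\<mu><..} s * (1 / s))"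
        by (simp only: integral_mult_right_zero K_int)
      also have "\<dots> = norm (1 / s * h' s)"
        using pos by (simp add: h'_def indicator_def)
      finally show "(\<integral>t. norm (h' s * K s t) \<partial>lborel) = norm (1 / s * h' s)" .
      show "integrable lborel (\<lambda>t. h' s * K s t)"
        unfolding K_def using inverse_eq_tail_integral(2)[of s] pos
        by (cases "\<mu> < s") (auto simp del: times_divide_eq_right intro!: integrable_mult_right)
    qed
    have "integrable (lborel \<Otimes>\<^sub>M lborel) (\<lambda>(s, t). h' s * K s t)"
    proof (rule lborel_pair.Fubini_integrable)
      show "(\<lambda>(s, t). h' s * K s t) \<in> borel_measurable (lborel \<Otimes>\<^sub>M lborel)"
        unfolding K_eq by measurable
      show "integrable lborel (\<lambda>s. \<integral>t. norm (case (s, t) of (s, t) \<Rightarrow> h' s * K s t) \<partial>lborel)"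
        unfolding prod.case inner_s by (rule integrable_norm[OF int'])
      show "AE s in lborel. integrable lborel (\<lambda>t. case (s, t) of (s, t) \<Rightarrow> h' s * K s t)"
        unfolding prod.case by (rule AE_I2) (rule inner_s(3))
    qed
    note swap = lborel_pair.Fubini_integral[OF this]
    have "(LINT s:{\<mu><..}|lborel. 1 / s * h s) = (\<integral>s. (\<integral>t. h' s * K s t \<partial>lborel) \<partial>lborel)"
      unfolding inner_s(1) by (simp add: set_lebesgue_integral_def h'_def mult.left_commute)
    also have "\<dots> = (\<integral>t. (\<integral>s. h' s * K s t \<partial>lborel) \<partial>lborel)"
      by (rule swap[symmetric])
    also have "\<dots> = (\<integral>t. - \<phi> t \<partial>lborel)"
    proof (intro Bochner_Integration.integral_cong refl)
      fix t :: real
      have "(\<integral>s. h' s * K s t \<partial>lborel) = (\<integral>s. (indicator {\<mu><..t} s * h s) * (1 / t\<^sup>2) \<partial>lborel)"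
        by (intro Bochner_Integration.integral_cong) (auto simp: h'_def K_def indicator_def)
      also have "\<dots> = (LINT s:{\<mu><..t}|lborel. h s) / t\<^sup>2"
        by (simp add: set_lebesgue_integral_def)
      also have "\<dots> = - \<phi> t"
      proof (cases "\<mu> < t")
        case True
        then show ?thesis
          using primitive[of t] by (simp add: \<phi>_def minus_divide_left)
      next
        case False
        then show ?thesis by (simp add: \<phi>_def set_lebesgue_integral_def)
      qed
      finally show "(\<integral>s. h' s * K s t \<partial>lborel) = - \<phi> t" .
    qed
    finally show ?thesis by simp
  qed
  show ?thesis
    unfolding stieltjes_tail_integral_def density
    using stieltjes by (simp add: N_def F_def[abs_def])
qed

section \<open>Integrating a family of primitives over a parameter\<close>

lemma sigma_finite_vol_on: "A \<in> sets borel \<Longrightarrow> sigma_finite_measure (vol_on A)"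
  by (rule sigma_finite_measure_restrict_space) (auto intro: lborel.sigma_finite_measure_axioms)

text \<open>The gauge integral of an everywhere defined
  derivative always recovers the increment of its primitive, and it agrees with the Lebesgue
  integral for those \<open>x\<close> for which the latter exists, which by Fubini's theorem is almost
  every \<open>x\<close>.\<close>

lemma integral_of_primitives:
  fixes g k :: "'b \<Rightarrow> real \<Rightarrow> real"
  assumes "sigma_finite_measure N" "0 < u" "u \<le> v"
    and deriv: "\<And>x s. x \<in> space N \<Longrightarrow> u \<le> s \<Longrightarrow> (g x has_real_derivative k x s) (at s)"
    and int_k: "integrable (N \<Otimes>\<^sub>M vol_on {u<..}) (\<lambda>(x, s). 1 / s * k x s)"
    and int_g: "\<And>s. u \<le> s \<Longrightarrow> integrable N (\<lambda>x. g x s)"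
  shows "(\<integral>x. g x v \<partial>N) - (\<integral>x. g x u \<partial>N) = (LINT s:{u<..v}|lborel. (\<integral>x. k x s \<partial>N))"
proof -
  interpret N: sigma_finite_measure N by fact
  interpret L: sigma_finite_measure "vol_on {u<..}"
    by (rule sigma_finite_vol_on) simp
  interpret pair_sigma_finite N "vol_on {u<..}" ..
  \<comment> \<open>equal to \<open>k x s\<close> for \<open>u < s \<le> v\<close>, written as a bounded multiple of the integrable function\<close>
  define \<phi> where "\<phi> x s = indicator {..v} s * s * (1 / s * k x s)" for x s
  have \<phi>_int: "integrable (N \<Otimes>\<^sub>M vol_on {u<..}) (\<lambda>(x, s). \<phi> x s)"
  proof (rule Bochner_Integration.integrable_bound)
    show "integrable (N \<Otimes>\<^sub>M vol_on {u<..}) (\<lambda>p. v * (case p of (x, s) \<Rightarrow> 1 / s * k x s))"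
      using int_k by simp
    have "(\<lambda>s::real. indicator {..v} s * s) \<in> borel_measurable (vol_on {u<..})"
      by (rule measurable_restrict_space1) measurable
    then have "(\<lambda>p. (indicator {..v} (snd p) * snd p) * (case p of (x, s) \<Rightarrow> 1 / s * k x s))
        \<in> borel_measurable (N \<Otimes>\<^sub>M vol_on {u<..})"
      using borel_measurable_integrable[OF int_k]
      by (rule borel_measurable_times[OF measurable_compose[OF measurable_snd]])
    then show "(\<lambda>(x, s). \<phi> x s) \<in> borel_measurable (N \<Otimes>\<^sub>M vol_on {u<..})"
      by (simp add: \<phi>_def case_prod_unfold)
    show "AE p in N \<Otimes>\<^sub>M vol_on {u<..}. norm (case p of (x, s) \<Rightarrow> \<phi> x s)
        \<le> norm (v * (case p of (x, s) \<Rightarrow> 1 / s * k x s))"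
      using \<open>0 < u\<close>
      by (auto simp: \<phi>_def space_pair_measure space_restrict_space indicator_def abs_mult
          field_simps intro!: AE_I2 mult_right_mono)
  qed
  have restrict: "indicator {u<..} s * \<phi> x s = indicator {u<..v} s * k x s" for x s
    using \<open>0 < u\<close> by (auto simp: \<phi>_def indicator_def)
  have FTC: "AE x in N. (\<integral>s. \<phi> x s \<partial>vol_on {u<..}) = g x v - g x u"
    using AE_space AE_integrable_fst'[OF \<phi>_int]
  proof eventually_elim
    case (elim x)
    then have "set_integrable lborel {u<..v} (k x)"
      by (simp add: integrable_restrict_space restrict set_integrable_def)
    moreover have "(k x has_integral (g x v - g x u)) {u..v}"
      using \<open>u \<le> v\<close> deriv[OF elim(1)]
      by (intro fundamental_theorem_of_calculus)
        (auto simp: has_real_derivative_iff_has_vector_derivative[symmetric]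
          intro: has_field_derivative_at_within)
    ultimately have "(LINT s:{u<..v}|lborel. k x s) = g x v - g x u"
      using set_integrable_Ioc_imp_Icc(2) integral_unique by metis
    then show ?case
      by (simp add: integral_restrict_space restrict set_lebesgue_integral_def)
  qed
  have "(\<integral>x. g x v \<partial>N) - (\<integral>x. g x u \<partial>N) = (\<integral>x. g x v - g x u \<partial>N)"
    using int_g \<open>u \<le> v\<close> by simp
  also have "\<dots> = (\<integral>x. (\<integral>s. \<phi> x s \<partial>vol_on {u<..}) \<partial>N)"
    using FTC int_g[OF order_refl] int_g[OF \<open>u \<le> v\<close>] integrable_fst'[OF \<phi>_int]
    by (intro integral_cong_AE) (auto dest: borel_measurable_integrable)
  also have "\<dots> = (\<integral>s. (\<integral>x. \<phi> x s \<partial>N) \<partial>vol_on {u<..})"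
    by (rule Fubini_integral[OF \<phi>_int, symmetric])
  also have "\<dots> = (LINT s:{u<..v}|lborel. (\<integral>x. k x s \<partial>N))"
    unfolding set_lebesgue_integral_def using \<open>0 < u\<close>
    by (subst integral_restrict_space)
      (auto simp: \<phi>_def indicator_def intro!: Bochner_Integration.integral_cong)
  finally show ?thesis .
qed


section \<open>The detection probability decreases with the threshold\<close>

lemma (in joint_detection) decision_stat_measurable:
  assumes loc [measurable]: "loc \<in> measurable M (vol_on X)"
  shows "(\<lambda>m. decision_stat X a0 a p0 p1 C R (loc m) \<mu> m) \<in> borel_measurable M"
proof -
  interpret V: sigma_finite_measure "vol_on X"
    by (rule sigma_finite_vol_on[OF domain_borel])
  have [measurable]: "p0 \<in> borel_measurable M" "a \<in> borel_measurable (vol_on X)"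
    "C \<in> borel_measurable (vol_on X)"
    using p0_integrable a_integrable C_measurable by auto
  note [measurable] = p1_measurable R_measurable
  have [measurable]: "(\<lambda>(m, x). R (loc m) x) \<in> borel_measurable (M \<Otimes>\<^sub>M vol_on X)"
    using measurable_compose[of "\<lambda>(m, x). (loc m, x)", OF _ R_measurable]
    by (simp add: case_prod_unfold)
  show ?thesis
    unfolding decision_stat_def marginal_def by measurable
qed

lemma (in joint_detection) decision_stat_antimono:
  assumes "x' \<in> X" "m \<in> space M" "s \<le> t"
  shows "decision_stat X a0 a p0 p1 C R x' t m \<le> decision_stat X a0 a p0 p1 C R x' s m"
proof -
  have "0 \<le> (\<integral>x. a x * p1 m x \<partial>vol_on X)"
    by (rule Bochner_Integration.integral_nonneg_AE)
      (use a_nonneg p1_nonneg assms(2) in \<open>auto simp: space_restrict_space intro!: AE_I2\<close>)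
  then have "0 \<le> 1 / marginal X a0 a p0 p1 m"
    using a0_pos p0_nonneg[OF assms(2)] by (simp add: marginal_def)
  moreover have "s * (C x' * p0 m * a0) \<le> t * (C x' * p0 m * a0)"
    using assms a0_pos p0_nonneg[OF assms(2)] C_pos[OF assms(1)] by (intro mult_right_mono) auto
  ultimately show ?thesis
    unfolding decision_stat_def by (intro mult_left_mono) (auto simp: mult.assoc)
qed

lemma (in joint_detection) pseudo_prior_nonneg:
  assumes "x \<in> X"
  shows "0 \<le> pseudo_prior X a0 a C R x"
  using assms a0_pos a_nonneg R_nonneg C_pos[OF assms] pseudo_prior_normalizable(2)
  by (simp add: pseudo_prior_def)

lemma (in joint_detection) pseudo_prior_integrable:
  "integrable (vol_on X) (pseudo_prior X a0 a C R)"
  unfolding pseudo_prior_def[abs_def] by (rule integrable_divide) (rule pseudo_prior_normalizable)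

text \<open>Here \<open>\<mu>\<close> is the raw cost factor; the densities \<open>pD\<close> and \<open>\<nu>F\<close> at threshold \<open>\<mu>\<close> belong to the
  cost factor \<open>\<kappa> * \<mu>\<close> with \<open>\<kappa>\<close> the value of \<^const>\<open>cost_scale\<close>.\<close>

definition (in declared_densities) declared :: "real \<Rightarrow> 'm set" where
  "declared \<mu> = {m \<in> space M. 0 < decision_stat X a0 a p0 p1 C R (xm \<mu> m) \<mu> m}"

lemma (in declared_densities) declared_measurable:
  "0 < \<mu> \<Longrightarrow> declared \<mu> \<in> sets M"
  unfolding declared_def using decision_stat_measurable[OF xm_measurable] by simp

text \<open>A location with positive statistic at the higher cost has one at least as large at the lower
  cost, and the maximizing location at the lower cost does at least as well. The maximizers themselves
  may differ. Maximality holds for almost every measurement, hence the form of the conclusion.\<close>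

lemma (in declared_densities) declared_antimono:
  assumes "0 < s" "s \<le> t"
  shows "AE m in M. m \<in> declared t \<longrightarrow> m \<in> declared s"
  using AE_space xm_maximizes[OF assms(1)] xm_maximizes[OF order_less_le_trans[OF assms]]
proof eventually_elim
  case (elim m)
  then have "xm t m \<in> X" "decision_stat X a0 a p0 p1 C R (xm t m) s m
      \<le> decision_stat X a0 a p0 p1 C R (xm s m) s m"
    by (auto simp: is_arg_max_def not_less)
  then show ?case
    using decision_stat_antimono[OF _ elim(1) assms(2), of "xm t m"] by (auto simp: declared_def)
qed

lemma (in declared_densities) pD_nonneg:
  "0 < \<mu> \<Longrightarrow> x \<in> X \<Longrightarrow> x' \<in> X \<Longrightarrow> 0 \<le> pD x' x \<mu>"
  using pD_density by (auto simp: declaration_density_def)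

text \<open>Comparing total masses in the defining property of the declaration density removes the declared
  location: what is left is the probability that something is declared. Measurability of
  the decision region is needed here, as otherwise the law of the measurement restricted to
  it would not be given by a density.\<close>

lemma (in declared_densities) nn_integral_pD:
  assumes "0 < \<mu>" "x \<in> X"
  shows "(\<integral>\<^sup>+x'. ennreal (pD x' x \<mu>) \<partial>vol_on X)
    = (\<integral>\<^sup>+m. ennreal (p1 m x) * indicator (declared (cost_scale X a0 a C R * \<mu>)) m \<partial>M)"
proof -
  define E where "E = declared (cost_scale X a0 a C R * \<mu>)"
  define q where "q m = ennreal (p1 m x) * indicator E m" for m
  define loc where "loc = xm (cost_scale X a0 a C R * \<mu>)"
  have pos: "0 < cost_scale X a0 a C R * \<mu>"
    using assms(1) pseudo_prior_normalizable(2) by simp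
  have [measurable]: "E \<in> sets M" "loc \<in> measurable M (vol_on X)"
      "(\<lambda>m. p1 m x) \<in> borel_measurable M"
    using declared_measurable[OF pos] xm_measurable[OF pos] p1_integrable[OF assms(2)]
    by (auto simp: E_def loc_def)
  have [measurable]: "q \<in> borel_measurable M"
    unfolding q_def by measurable
  have [measurable]: "(\<lambda>x'. pD x' x \<mu>) \<in> borel_measurable (vol_on X)"
    and eq: "distr (density M q) (vol_on X) loc = density (vol_on X) (\<lambda>x'. ennreal (pD x' x \<mu>))"
    using pD_density[OF assms]
    by (simp_all add: declaration_density_def q_def[abs_def] E_def loc_def declared_def)
  have "(\<integral>\<^sup>+x'. ennreal (pD x' x \<mu>) \<partial>vol_on X)
      = emeasure (density (vol_on X) (\<lambda>x'. ennreal (pD x' x \<mu>))) (space (vol_on X))"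
    by (subst emeasure_density) (auto intro!: nn_integral_cong)
  also have "\<dots> = emeasure (density M q) (space M)"
    unfolding eq[symmetric]
    by (subst emeasure_distr) (auto dest: measurable_space[OF \<open>loc \<in> measurable M (vol_on X)\<close>] intro!: arg_cong[where f="emeasure _"])
  also have "\<dots> = (\<integral>\<^sup>+m. q m \<partial>M)"
    by (subst emeasure_density) (auto intro!: nn_integral_cong)
  finally show ?thesis
    by (simp add: q_def E_def)
qed

lemma (in declared_densities) nn_integral_pD_le_1:
  assumes "0 < \<mu>" "x \<in> X"
  shows "(\<integral>\<^sup>+x'. ennreal (pD x' x \<mu>) \<partial>vol_on X) \<le> 1"
proof -
  have "(\<integral>\<^sup>+x'. ennreal (pD x' x \<mu>) \<partial>vol_on X) \<le> (\<integral>\<^sup>+m. ennreal (p1 m x) \<partial>M)"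
    unfolding nn_integral_pD[OF assms] by (intro nn_integral_mono) (auto simp: indicator_def)
  also have "\<dots> = 1"
    using assms p1_integrable p1_total p1_nonneg by (subst nn_integral_eq_integral) auto
  finally show ?thesis .
qed

lemma (in declared_densities) pD_integrable:
  assumes "0 < \<mu>" "x \<in> X"
  shows "integrable (vol_on X) (\<lambda>x'. pD x' x \<mu>)"
proof (rule integrableI_nonneg)
  show "(\<lambda>x'. pD x' x \<mu>) \<in> borel_measurable (vol_on X)"
    using pD_density[OF assms] by (simp add: declaration_density_def)
  show "AE x' in vol_on X. 0 \<le> pD x' x \<mu>"
    using pD_nonneg[OF assms] by (auto simp: space_restrict_space)
  show "(\<integral>\<^sup>+x'. ennreal (pD x' x \<mu>) \<partial>vol_on X) < \<infinity>"
    using nn_integral_pD_le_1[OF assms] by (simp add: le_less_trans)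
qed

lemma (in declared_densities) ennreal_detection_prob:
  assumes "0 < \<mu>" "x \<in> X"
  shows "ennreal (detection_prob X pD x \<mu>) = (\<integral>\<^sup>+x'. ennreal (pD x' x \<mu>) \<partial>vol_on X)"
  unfolding detection_prob_def using pD_nonneg[OF assms] pD_integrable[OF assms]
  by (intro nn_integral_eq_integral[symmetric]) (auto simp: space_restrict_space)

lemma (in declared_densities) detection_prob_nonneg:
  assumes "0 < \<mu>" "x \<in> X"
  shows "0 \<le> detection_prob X pD x \<mu>"
  unfolding detection_prob_def using pD_nonneg[OF assms]
  by (intro integral_nonneg_AE) (auto simp: space_restrict_space)

lemma (in declared_densities) detection_prob_le_1:
  assumes "0 < \<mu>" "x \<in> X"
  shows "detection_prob X pD x \<mu> \<le> 1"
  using nn_integral_pD_le_1[OF assms] by (simp add: ennreal_detection_prob[OF assms, symmetric])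

lemma (in declared_densities) detection_prob_antimono:
  assumes "0 < s" "s \<le> t" "x \<in> X"
  shows "detection_prob X pD x t \<le> detection_prob X pD x s"
proof -
  let ?\<kappa> = "cost_scale X a0 a C R"
  have "AE m in M. m \<in> declared (?\<kappa> * t) \<longrightarrow> m \<in> declared (?\<kappa> * s)"
    using assms pseudo_prior_normalizable(2) by (intro declared_antimono) auto
  then have "(\<integral>\<^sup>+m. ennreal (p1 m x) * indicator (declared (?\<kappa> * t)) m \<partial>M)
      \<le> (\<integral>\<^sup>+m. ennreal (p1 m x) * indicator (declared (?\<kappa> * s)) m \<partial>M)"
    by (intro nn_integral_mono_AE) (auto simp: indicator_def elim!: eventually_mono)
  then have "ennreal (detection_prob X pD x t) \<le> ennreal (detection_prob X pD x s)"
    using assms by (simp add: ennreal_detection_prob nn_integral_pD)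
  then show ?thesis
    using detection_prob_nonneg[OF assms(1,3)] by simp
qed

section \<open>Averages over the pseudo-prior\<close>

lemma (in declared_densities) weighted_pD_integrable:
  assumes "0 < \<mu>"
    and [measurable]: "(\<lambda>(x', x). pD x' x \<mu>) \<in> borel_measurable (vol_on X \<Otimes>\<^sub>M vol_on X)"
  shows "integrable (vol_on X) (\<lambda>x. pseudo_prior X a0 a C R x * detection_prob X pD x \<mu>)"
    and "integrable (vol_on X \<Otimes>\<^sub>M vol_on X) (\<lambda>(x, x'). pseudo_prior X a0 a C R x * pD x' x \<mu>)"
proof -
  interpret V: sigma_finite_measure "vol_on X"
    by (rule sigma_finite_vol_on[OF domain_borel])
  interpret VV: pair_sigma_finite "vol_on X" "vol_on X" ..
  let ?a' = "pseudo_prior X a0 a C R"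
  have [measurable]: "?a' \<in> borel_measurable (vol_on X)"
    using pseudo_prior_integrable by auto
  have [measurable]: "(\<lambda>x. detection_prob X pD x \<mu>) \<in> borel_measurable (vol_on X)"
    unfolding detection_prob_def by measurable
  show int: "integrable (vol_on X) (\<lambda>x. ?a' x * detection_prob X pD x \<mu>)"
  proof (rule Bochner_Integration.integrable_bound[OF pseudo_prior_integrable])
    show "AE x in vol_on X. norm (?a' x * detection_prob X pD x \<mu>) \<le> norm (?a' x)"
      using detection_prob_nonneg[OF assms(1)] detection_prob_le_1[OF assms(1)]
      by (auto simp: space_restrict_space abs_mult intro!: AE_I2 mult_left_le)
  qed measurable
  show "integrable (vol_on X \<Otimes>\<^sub>M vol_on X) (\<lambda>(x, x'). ?a' x * pD x' x \<mu>)"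
  proof (rule VV.Fubini_integrable)
    show "(\<lambda>(x, x'). ?a' x * pD x' x \<mu>) \<in> borel_measurable (vol_on X \<Otimes>\<^sub>M vol_on X)"
      by measurable
    have "(\<integral>x'. norm (case (x, x') of (x, x') \<Rightarrow> ?a' x * pD x' x \<mu>) \<partial>vol_on X)
        = ?a' x * detection_prob X pD x \<mu>" if "x \<in> X" for x
    proof -
      have "(\<integral>x'. norm (case (x, x') of (x, x') \<Rightarrow> ?a' x * pD x' x \<mu>) \<partial>vol_on X)
          = (\<integral>x'. ?a' x * pD x' x \<mu> \<partial>vol_on X)"
        using pseudo_prior_nonneg pD_nonneg[OF assms(1)] that
        by (intro Bochner_Integration.integral_cong) (auto simp: space_restrict_space abs_mult)
      then show ?thesis
        by (simp add: detection_prob_def)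
    qed
    with int show "integrable (vol_on X)
        (\<lambda>x. \<integral>x'. norm (case (x, x') of (x, x') \<Rightarrow> ?a' x * pD x' x \<mu>) \<partial>vol_on X)"
      by (subst Bochner_Integration.integrable_cong[OF refl]) (auto simp: space_restrict_space)
    show "AE x in vol_on X. integrable (vol_on X) (\<lambda>x'. case (x, x') of (x, x') \<Rightarrow> ?a' x * pD x' x \<mu>)"
      using pD_integrable[OF assms(1)] by (auto simp: space_restrict_space)
  qed
qed

text \<open>The pseudo-prior average and the integral over the declared location may be taken in either
  order.\<close>

lemma (in declared_densities) net_detection_prob_eq_integral:
  assumes "0 < \<mu>"
    and meas: "(\<lambda>(x', x). pD x' x \<mu>) \<in> borel_measurable (vol_on X \<Otimes>\<^sub>M vol_on X)"
  shows "integrable (vol_on X) (\<lambda>x'. net_detection_density X (pseudo_prior X a0 a C R) pD x' \<mu>)"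
    and "net_detection_prob X (pseudo_prior X a0 a C R) pD \<mu>
      = (\<integral>x'. net_detection_density X (pseudo_prior X a0 a C R) pD x' \<mu> \<partial>vol_on X)"
proof -
  interpret V: sigma_finite_measure "vol_on X"
    by (rule sigma_finite_vol_on[OF domain_borel])
  interpret VV: pair_sigma_finite "vol_on X" "vol_on X" ..
  note int = weighted_pD_integrable(2)[OF assms]
  show "integrable (vol_on X) (\<lambda>x'. net_detection_density X (pseudo_prior X a0 a C R) pD x' \<mu>)"
    unfolding net_detection_density_def using VV.integrable_snd[OF int] .
  show "net_detection_prob X (pseudo_prior X a0 a C R) pD \<mu>
      = (\<integral>x'. net_detection_density X (pseudo_prior X a0 a C R) pD x' \<mu> \<partial>vol_on X)"
    unfolding net_detection_prob_def net_detection_density_def detection_prob_def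
    using VV.Fubini_integral[OF int] by simp
qed

lemma (in declared_densities) net_detection_prob_antimono:
  assumes "0 < s" "s \<le> t"
    and meas: "\<And>\<mu>. 0 < \<mu> \<Longrightarrow>
      (\<lambda>(x', x). pD x' x \<mu>) \<in> borel_measurable (vol_on X \<Otimes>\<^sub>M vol_on X)"
  shows "net_detection_prob X (pseudo_prior X a0 a C R) pD t
    \<le> net_detection_prob X (pseudo_prior X a0 a C R) pD s"
  unfolding net_detection_prob_def using assms
  by (intro integral_mono weighted_pD_integrable(1) mult_left_mono detection_prob_antimono
      pseudo_prior_nonneg) (auto simp: space_restrict_space)

section \<open>False alarms from detections\<close>

theorem theorem5:
  fixes M :: "'m measure"
    and X :: "'a::euclidean_space set"
    and a0 :: real
    and a :: "'a \<Rightarrow> real"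
    and p0 :: "'m \<Rightarrow> real"
    and p1 :: "'m \<Rightarrow> 'a \<Rightarrow> real"
    and C :: "'a \<Rightarrow> real"
    and R :: "'a \<Rightarrow> 'a \<Rightarrow> real"
    and xm :: "real \<Rightarrow> 'm \<Rightarrow> 'a"
    and pD :: "'a \<Rightarrow> 'a \<Rightarrow> real \<Rightarrow> real"
    and \<nu>F :: "'a \<Rightarrow> real \<Rightarrow> real"
    and \<mu> :: real
  assumes setting: "declared_densities M X a0 a p0 p1 C R xm pD \<nu>F"
    and pD_measurable: "\<And>\<mu>. 0 < \<mu> \<Longrightarrow>
      (\<lambda>(x', x). pD x' x \<mu>) \<in> borel_measurable (vol_on X \<Otimes>\<^sub>M vol_on X)"
    and pD_differentiable: "\<And>x' x \<mu>. x' \<in> X \<Longrightarrow> x \<in> X \<Longrightarrow> 0 < \<mu> \<Longrightarrow>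
      (\<lambda>s. pD x' x s) differentiable (at \<mu>)"
    and derivative_under_integral: "\<And>x' \<mu>. x' \<in> X \<Longrightarrow> 0 < \<mu> \<Longrightarrow>
      ((\<lambda>s. net_detection_density X (pseudo_prior X a0 a C R) pD x' s) has_real_derivative
        (\<integral>x. pseudo_prior X a0 a C R x * deriv (\<lambda>s. pD x' x s) \<mu> \<partial>vol_on X)) (at \<mu>)"
    and interchange_integrals: "\<And>\<mu>. 0 < \<mu> \<Longrightarrow>
      integrable (vol_on X \<Otimes>\<^sub>M vol_on {\<mu><..})
        (\<lambda>(x', s). 1 / s * deriv (\<lambda>s. net_detection_density X (pseudo_prior X a0 a C R) pD x' s) s)"
    and detections_vanish: "\<And>x. x \<in> X \<Longrightarrow> (detection_prob X pD x \<longlongrightarrow> 0) at_top"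
    and density_relation: "\<And>x' \<mu>. x' \<in> X \<Longrightarrow> 0 < \<mu> \<Longrightarrow>
      \<nu>F x' \<mu> = - (LINT s:{\<mu><..}|lborel.
        1 / s * deriv (\<lambda>s. net_detection_density X (pseudo_prior X a0 a C R) pD x' s) s)"
    and "0 < \<mu>"
  shows "net_false_alarm_prob X \<nu>F \<mu> =
    - stieltjes_tail_integral (\<lambda>s. 1 / s) (net_detection_prob X (pseudo_prior X a0 a C R) pD) \<mu>"
proof -
  interpret declared_densities M X a0 a p0 p1 C R xm pD \<nu>F
    by (rule setting)
  interpret V: sigma_finite_measure "vol_on X"
    by (rule sigma_finite_vol_on[OF domain_borel])
  interpret L: sigma_finite_measure "vol_on {\<mu><..}"
    by (rule sigma_finite_vol_on) simp
  interpret VL: pair_sigma_finite "vol_on X" "vol_on {\<mu><..}" ..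
  define g where "g = net_detection_density X (pseudo_prior X a0 a C R) pD"
  define G where "G = net_detection_prob X (pseudo_prior X a0 a C R) pD"
  define h where "h s = (\<integral>x'. deriv (g x') s \<partial>vol_on X)" for s
  have int: "integrable (vol_on X \<Otimes>\<^sub>M vol_on {\<mu><..}) (\<lambda>(x', s). 1 / s * deriv (g x') s)"
    using interchange_integrals[OF \<open>0 < \<mu>\<close>] by (simp add: g_def)
  have g_deriv: "(g x' has_real_derivative deriv (g x') s) (at s)" if "x' \<in> X" "0 < s" for x' s
    using derivative_under_integral[OF that] DERIV_imp_deriv unfolding g_def by metis
  have "net_false_alarm_prob X \<nu>F \<mu>
      = (\<integral>x'. - (\<integral>s. 1 / s * deriv (g x') s \<partial>vol_on {\<mu><..}) \<partial>vol_on X)"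
    unfolding net_false_alarm_prob_def
    by (intro Bochner_Integration.integral_cong refl)
      (simp add: density_relation[OF _ \<open>0 < \<mu>\<close>] space_restrict_space integral_restrict_space
        set_lebesgue_integral_def g_def)
  also have "\<dots> = - (\<integral>s. (\<integral>x'. 1 / s * deriv (g x') s \<partial>vol_on X) \<partial>vol_on {\<mu><..})"
    using VL.Fubini_integral[OF int] by simp
  also have "\<dots> = - (LINT s:{\<mu><..}|lborel. 1 / s * h s)"
    by (simp add: integral_restrict_space set_lebesgue_integral_def h_def)
  also have "(LINT s:{\<mu><..}|lborel. 1 / s * h s) = stieltjes_tail_integral (\<lambda>s. 1 / s) G \<mu>"
  proof (rule stieltjes_tail_integral_inverse[symmetric, OF \<open>0 < \<mu>\<close>])
    show "G t \<le> G s" if "\<mu> \<le> s" "s \<le> t" for s t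
      unfolding G_def using that \<open>0 < \<mu>\<close> pD_measurable by (intro net_detection_prob_antimono) auto
    have "integrable (vol_on {\<mu><..}) (\<lambda>s. 1 / s * h s)"
      using VL.integrable_snd[OF int] by (simp add: h_def)
    then show "set_integrable lborel {\<mu><..} (\<lambda>s. 1 / s * h s)"
      by (simp add: integrable_restrict_space set_integrable_def)
    show "G t - G \<mu> = (LINT s:{\<mu><..t}|lborel. h s)" if "\<mu> \<le> t" for t
    proof -
      have "(\<integral>x'. g x' t \<partial>vol_on X) - (\<integral>x'. g x' \<mu> \<partial>vol_on X) = (LINT s:{\<mu><..t}|lborel. h s)"
        unfolding h_def
        by (rule integral_of_primitives[OF sigma_finite_vol_on[OF domain_borel] \<open>0 < \<mu>\<close> that _ int])
          (use \<open>0 < \<mu>\<close> pD_measurable g_deriv net_detection_prob_eq_integral(1) in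
            \<open>auto simp: space_restrict_space g_def\<close>)
      then show ?thesis
        using \<open>0 < \<mu>\<close> that pD_measurable
        by (simp add: G_def g_def net_detection_prob_eq_integral(2))
    qed
  qed
  finally show ?thesis
    by (simp add: G_def)
qed

end
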